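(* For all non-negative integers $\ell_1,\ell_2$ and all integers $k_1,k_2$, $$\mathbb{B}_{\ell_1,\ell_2}^{(k_1,k_2)}=\sum_{m_1=0}^{\ell_1+\ell_2}\ \sum_{m_2=0}^{\ell_1+\ell_2}\frac{(-1)^{m_1+m_2+\ell_1+\ell_2}\,m_1!\,m_2!}{(m_1+1)^{k_1}(m_1+m_2+2)^{k_2}}\sum_{n=0}^{\ell_1+\ell_2}\genfrac{\{}{\}}{0pt}{}{n}{m_1}\genfrac{\{}{\}}{0pt}{}{\ell_1+\ell_2-n}{m_2}\binom{\ell_2}{n-\ell_1}.$$
   Context: For integers $k_1,k_2$ and $|z_1|,|z_2|<1$ put $$\mathrm{Li}^{\mathrm{sh}}_{k_1,k_2}(z_1,z_2)=\sum_{1\le m_1<m_2}\frac{z_1^{m_1}z_2^{m_2-m_1}}{m_1^{k_1}m_2^{k_2}}.$$ The double-indexed poly-Bernoulli numbers $\mathbb{B}_{m_1,m_2}^{(k_1,k_2)}$ are defined by $$\frac{\mathrm{Li}^{\mathrm{sh}}_{k_1,k_2}(1-e^{-x_1-x_2},\,1-e^{-x_2})}{(1-e^{-x_1-x_2})(1-e^{-x_2})}=\sum_{m_1,m_2\ge0}\mathbb{B}_{m_1,m_2}^{(k_1,k_2)}\frac{x_1^{m_1}x_2^{m_2}}{m_1!\,m_2!}.$$ The Stirling numbers of the second kind $\genfrac{\{}{\}}{0pt}{}{n}{m}$ are given by $\genfrac{\{}{\}}{0pt}{}{0}{0}=1$, $\genfrac{\{}{\}}{0pt}{}{n}{0}=\genfrac{\{}{\}}{0pt}{}{0}{m}=0$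 for $n,m\ne0$, and $\genfrac{\{}{\}}{0pt}{}{n+1}{m}=\genfrac{\{}{\}}{0pt}{}{n}{m-1}+m\genfrac{\{}{\}}{0pt}{}{n}{m}$. The binomial coefficient $\binom{\ell}{n}$ is $0$ when $n<0$ or $n>\ell$. *)

theory Defs
  imports "HOL-Analysis.Analysis" "HOL-Combinatorics.Stirling"
begin

definition Li_sh :: "int \<Rightarrow> int \<Rightarrow> complex \<Rightarrow> complex \<Rightarrow> complex" where
  "Li_sh k1 k2 z1 z2 =
     (\<Sum>\<^sub>\<infinity>(m1, m2)\<in>{(m1::nat, m2::nat). 1 \<le> m1 \<and> m1 < m2}.
        z1 ^ m1 * z2 ^ (m2 - m1) / (of_nat m1 powi k1 * of_nat m2 powi k2))"

text \<open>
  The generating function has removable singularities where a factor of its denominator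
  vanishes. Such points accumulate at the origin, so the expansion is demanded at all
  points near the origin outside this nowhere dense set, which determines the coefficients.
  The double series is summed unconditionally, hence absolutely.
\<close>

definition double_poly_bernoulli_expansion ::
    "int \<Rightarrow> int \<Rightarrow> (nat \<Rightarrow> nat \<Rightarrow> complex) \<Rightarrow> bool" where
  "double_poly_bernoulli_expansion k1 k2 B \<longleftrightarrow>
     (\<forall>\<^sub>F (x1, x2) in nhds (0, 0).
        1 - exp (- x1 - x2) \<noteq> 0 \<longrightarrow> 1 - exp (- x2) \<noteq> 0 \<longrightarrow>
        ((\<lambda>(m1, m2). B m1 m2 * (x1 ^ m1 * x2 ^ m2 / (fact m1 * fact m2))) has_sum
          Li_sh k1 k2 (1 - exp (- x1 - x2)) (1 - exp (- x2)) /
            ((1 - exp (- x1 - x2)) * (1 - exp (- x2)))) UNIV)"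

definition double_poly_bernoulli :: "int \<Rightarrow> int \<Rightarrow> nat \<Rightarrow> nat \<Rightarrow> complex" where
  "double_poly_bernoulli k1 k2 = (THE B. double_poly_bernoulli_expansion k1 k2 B)"

text \<open>The lower argument is an integer, so that negative values give 0.\<close>

definition binom_int :: "nat \<Rightarrow> int \<Rightarrow> nat" where
  "binom_int l j = (if j < 0 then 0 else l choose nat j)"

end

theory Submission
  imports Defs
begin

text \<open>
  Dividing the double polylogarithm by its two arguments shifts both summation indices to start
  at 0, so the generating function is the double power series
  \<open>\<Sum>a b. z1^a * z2^b / ((a + 1)^k1 * (a + b + 2)^k2)\<close> at \<open>z1 = 1 - exp (- x1 - x2)\<close>,
  \<open>z2 = 1 - exp (- x2)\<close> (\<open>Li_sh_divide\<close>). Each monomial in \<open>z1\<close>, \<open>z2\<close> has an everywhere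
  convergent expansion in \<open>x1\<close>, \<open>x2\<close>: since \<open>(exp u - 1)^a\<close> is the exponential generating
  function of \<open>a!\<close> times the Stirling numbers \<open>Stirling n a\<close>, expanding
  \<open>(x1 + x2)^n\<close> by the binomial theorem produces exactly the inner sum of the formula
  (\<open>egf_has_sum\<close>). Collecting the coefficient of \<open>x1^l1 * x2^l2\<close> over all \<open>a\<close>, \<open>b\<close> gives
  the claim; only \<open>a, b \<le> l1 + l2\<close> contribute because Stirling numbers vanish above the diagonal.

  Two analytic points remain. Exchanging the two double sums needs absolute summability near the
  origin (\<open>substitution_has_sum\<close>): all coefficients of \<open>(exp (x + y) - 1)^a * (exp y - 1)^b\<close>
  are nonnegative, so the sum of absolute values is the same product at the norms of the
  variables, which is small near the origin, while the weights grow at most geometrically.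
  And the coefficients must be determined by the values outside the
  removable singularities (\<open>double_powser_coeffs_eq_0\<close>): on a horizontal line
  \<open>x2 = y \<noteq> 0\<close> the only excluded point near the origin is \<open>x1 = - y\<close>, so a punctured disc
  around 0 survives, and a one-variable argument applies twice.
\<close>

section \<open>Unconditional sums of products\<close>

lemma has_sum_sum:
  fixes f :: "'i \<Rightarrow> 'a \<Rightarrow> 'b :: topological_comm_monoid_add"
  assumes "finite I" "\<And>i. i \<in> I \<Longrightarrow> (f i has_sum s i) A"
  shows "((\<lambda>x. \<Sum>i\<in>I. f i x) has_sum (\<Sum>i\<in>I. s i)) A"
  using assms by (induction I rule: finite_induct) (auto intro: has_sum_add)

lemma has_sum_mult_Times:
  fixes f :: "'a \<Rightarrow> 'c :: {real_normed_field, banach}" and g :: "'b \<Rightarrow> 'c"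
  assumes "(\<lambda>i. norm (f i)) summable_on A" "(\<lambda>j. norm (g j)) summable_on B"
    and f: "(f has_sum a) A" and g: "(g has_sum b) B"
  shows "((\<lambda>(i, j). f i * g j) has_sum a * b) (A \<times> B)"
proof (rule has_sum_SigmaI)
  show "((\<lambda>j. case (i, j) of (i, j) \<Rightarrow> f i * g j) has_sum f i * b) B" for i
    using has_sum_cmult_right[OF g, of "f i"] by simp
  show "((\<lambda>i. f i * b) has_sum a * b) A"
    by (rule has_sum_cmult_left[OF f])
  have "(\<lambda>(i, j). norm (f i) * norm (g j)) summable_on (A \<times> B)"
  proof (rule summable_on_SigmaI)
    show "((\<lambda>j. case (i, j) of (i, j) \<Rightarrow> norm (f i) * norm (g j)) has_sum
        norm (f i) * (\<Sum>\<^sub>\<infinity>j\<in>B. norm (g j))) B" for i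
      using has_sum_cmult_right[OF has_sum_infsum[OF assms(2)], of "norm (f i)"] by simp
    show "(\<lambda>i. norm (f i) * (\<Sum>\<^sub>\<infinity>j\<in>B. norm (g j))) summable_on A"
      by (rule summable_on_cmult_left[OF assms(1)])
  qed auto
  then have "(\<lambda>p. norm (case p of (i, j) \<Rightarrow> f i * g j)) summable_on (A \<times> B)"
    by (simp add: case_prod_unfold norm_mult)
  then show "(\<lambda>(i, j). f i * g j) summable_on (A \<times> B)"
    by (rule abs_summable_summable)
qed

lemma exp_abs_summable:
  fixes x :: "'a :: {real_normed_field, banach}"
  shows "(\<lambda>n. norm (x ^ n / fact n)) summable_on UNIV"
proof -
  have "summable (\<lambda>n. norm (norm (x ^ n / fact n)))"
    using summable_norm_exp[of x] by (simp add: scaleR_conv_of_real field_simps)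
  from norm_summable_imp_summable_on[OF this] show ?thesis .
qed

lemma exp_has_sum:
  fixes x :: "'a :: {real_normed_field, banach}"
  shows "((\<lambda>n. x ^ n / fact n) has_sum exp x) UNIV"
  using norm_summable_imp_has_sum[OF summable_norm_exp exp_converges, of x]
  by (simp add: scaleR_conv_of_real field_simps)

section \<open>Stirling numbers and a bivariate exponential generating function\<close>

text \<open>
  The classical count of surjections by inclusion and exclusion. As a function of \<open>n\<close> the right-hand
  side is a combination of the powers \<open>j ^ n\<close>, so generating functions built from Stirling numbers
  become finite combinations of exponentials.
\<close>

lemma Stirling_alternating_sum:
  "fact a * of_nat (Stirling n a) =
     (\<Sum>j\<le>a. (- 1) ^ (a + j) * of_nat (a choose j) * (of_nat j ^ n :: 'a :: {comm_ring_1, ring_char_0}))"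
  (is "_ = ?T n a")
proof (induction n arbitrary: a)
  case 0
  have "?T 0 a = (- 1) ^ a * (\<Sum>j\<le>a. of_nat (a choose j) * (- 1) ^ j * 1 ^ (a - j))"
    by (simp add: sum_distrib_left power_add mult_ac)
  also have "\<dots> = (- 1) ^ a * (- 1 + 1) ^ a"
    by (subst binomial_ring) simp
  finally show ?case
    by (cases a) simp_all
next
  case (Suc n)
  show ?case
  proof (cases a)
    case 0
    then show ?thesis by simp
  next
    case (Suc b)
    \<comment> \<open>A vanishing last term lets the sums for \<open>b\<close> and \<open>Suc b\<close> be merged by Pascal's rule.\<close>
    have ext: "?T n b = (\<Sum>j\<le>Suc b. (- 1) ^ (b + j) * of_nat (b choose j) * of_nat j ^ n)"
      by (simp add: binomial_eq_0)
    have "?T (Suc n) a = (\<Sum>i\<le>b. (- 1) ^ (b + i) *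
        (of_nat (Suc b choose Suc i) * of_nat (Suc i)) * of_nat (Suc i) ^ n)"
      unfolding Suc by (subst sum.atMost_Suc_shift) (simp add: mult_ac)
    also have "\<dots> = (\<Sum>i\<le>b. (- 1) ^ (b + i) *
        (of_nat (Suc b) * of_nat (b choose i)) * of_nat (Suc i) ^ n)"
      by (simp only: of_nat_mult[symmetric] Suc_times_binomial_eq[symmetric])
    also have "\<dots> = of_nat (Suc b) *
        (\<Sum>i\<le>b. (- 1) ^ (b + i) * of_nat (b choose i) * of_nat (Suc i) ^ n)"
      by (simp only: sum_distrib_left mult_ac)
    also have "(\<Sum>i\<le>b. (- 1) ^ (b + i) * of_nat (b choose i) * of_nat (Suc i) ^ n)
        = ?T n (Suc b) + ?T n b"
      unfolding ext
      by (subst (1 2) sum.atMost_Suc_shift) (simp add: sum.distrib[symmetric] algebra_simps)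
    also have "of_nat (Suc b) * (?T n (Suc b) + ?T n b) =
        of_nat (Suc b) * (fact (Suc b) * of_nat (Stirling n (Suc b)) +
          fact b * of_nat (Stirling n b))"
      by (simp only: Suc.IH)
    also have "\<dots> = fact a * of_nat (Stirling (Suc n) a)"
      unfolding Suc by (simp add: algebra_simps)
    finally show ?thesis by simp
  qed
qed

text \<open>
  The coefficient of \<open>x^l1 * y^l2 / (l1! * l2!)\<close> in \<open>(exp (x + y) - 1)^a * (exp y - 1)^b\<close>.
  Taking it in the natural numbers makes its nonnegativity, on which absolute summability rests,
  part of its type.
\<close>

definition egf_coeff :: "nat \<Rightarrow> nat \<Rightarrow> nat \<Rightarrow> nat \<Rightarrow> nat" where
  "egf_coeff a b l1 l2 = fact a * fact b *
     (\<Sum>n=0..l1 + l2. Stirling n a * Stirling (l1 + l2 - n) b * binom_int l2 (int n - int l1))"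

lemma egf_coeff_eq_0:
  assumes "l1 + l2 < a \<or> l1 + l2 < b"
  shows "egf_coeff a b l1 l2 = 0"
  using assms by (auto simp: egf_coeff_def intro!: sum.neutral)

text \<open>
  The binomial coefficient restricts \<open>n\<close> to \<open>l1, ..., l1 + l2\<close>; with \<open>n = l1 + q\<close> the sum becomes a
  binomial convolution.
\<close>

lemma egf_coeff_shift:
  "egf_coeff a b l1 l2 = (\<Sum>q\<le>l2. (l2 choose q) *
     (fact a * Stirling (l1 + q) a) * (fact b * Stirling (l2 - q) b))"
proof -
  let ?g = "\<lambda>n. Stirling n a * Stirling (l1 + l2 - n) b * binom_int l2 (int n - int l1)"
  have "(\<Sum>n=0..l1 + l2. ?g n) = (\<Sum>n=l1..l1 + l2. ?g n)"
    by (rule sum.mono_neutral_right) (auto simp: binom_int_def)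
  also have "\<dots> = (\<Sum>q\<le>l2. ?g (l1 + q))"
    by (rule sum.reindex_bij_witness[of _ "\<lambda>q. l1 + q" "\<lambda>n. n - l1"]) auto
  also have "\<dots> = (\<Sum>q\<le>l2. (l2 choose q) * Stirling (l1 + q) a * Stirling (l2 - q) b)"
    by (simp add: binom_int_def mult_ac)
  finally show ?thesis
    by (simp add: egf_coeff_def sum_distrib_left mult_ac)
qed

text \<open>
  After writing both Stirling numbers as alternating sums, the convolution over \<open>q\<close> is the binomial
  expansion of \<open>(j + k) ^ l2\<close>.
\<close>

lemma egf_coeff_alternating_sum:
  "of_nat (egf_coeff a b l1 l2) =
     (\<Sum>j\<le>a. \<Sum>k\<le>b. (- 1) ^ (a + j) * of_nat (a choose j) * ((- 1) ^ (b + k) * of_nat (b choose k)) *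
        (of_nat j ^ l1 * of_nat (j + k) ^ l2 :: 'a :: {comm_ring_1, ring_char_0}))"
proof -
  let ?A = "\<lambda>j. (- 1) ^ (a + j) * of_nat (a choose j) :: 'a"
  let ?B = "\<lambda>k. (- 1) ^ (b + k) * of_nat (b choose k) :: 'a"
  have "of_nat (egf_coeff a b l1 l2) = (\<Sum>q\<le>l2. of_nat (l2 choose q) *
      ((fact a * of_nat (Stirling (l1 + q) a)) * (fact b * of_nat (Stirling (l2 - q) b))) :: 'a)"
    by (simp add: egf_coeff_shift mult.assoc)
  also have "\<dots> = (\<Sum>q\<le>l2. \<Sum>j\<le>a. \<Sum>k\<le>b. of_nat (l2 choose q) *
      ((?A j * of_nat j ^ (l1 + q)) * (?B k * of_nat k ^ (l2 - q))))"
    by (simp only: Stirling_alternating_sum sum_product) (simp only: sum_distrib_left)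
  also have "\<dots> = (\<Sum>j\<le>a. \<Sum>k\<le>b. \<Sum>q\<le>l2. of_nat (l2 choose q) *
      ((?A j * of_nat j ^ (l1 + q)) * (?B k * of_nat k ^ (l2 - q))))"
    by (subst sum.swap, rule sum.cong[OF refl], rule sum.swap)
  also have "\<dots> = (\<Sum>j\<le>a. \<Sum>k\<le>b. ?A j * ?B k * (of_nat j ^ l1 * of_nat (j + k) ^ l2))"
  proof (intro sum.cong refl)
    fix j k
    have "of_nat (j + k) ^ l2 =
        (\<Sum>q\<le>l2. of_nat (l2 choose q) * of_nat j ^ q * (of_nat k ^ (l2 - q) :: 'a))"
      by (simp only: of_nat_add binomial_ring)
    then show "(\<Sum>q\<le>l2. of_nat (l2 choose q) *
        ((?A j * of_nat j ^ (l1 + q)) * (?B k * of_nat k ^ (l2 - q)))) =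
        ?A j * ?B k * (of_nat j ^ l1 * of_nat (j + k) ^ l2)"
      by (simp only: sum_distrib_left power_add mult_ac)
  qed
  finally show ?thesis .
qed

lemma exp_minus_1_power:
  fixes u :: "'a :: {real_normed_field, banach}"
  shows "(exp u - 1) ^ a = (\<Sum>j\<le>a. (- 1) ^ (a + j) * of_nat (a choose j) * exp (of_nat j * u))"
proof -
  have "(exp u - 1) ^ a = (\<Sum>j\<le>a. of_nat (a choose j) * exp u ^ j * (- 1) ^ (a - j))"
    using binomial_ring[of "exp u" "- 1" a] by simp
  also have "\<dots> = (\<Sum>j\<le>a. (- 1) ^ (a + j) * of_nat (a choose j) * exp (of_nat j * u))"
  proof (rule sum.cong)
    fix j assume "j \<in> {..a}"
    then have "(- 1 :: 'a) ^ (a - j) = (- 1) ^ (a + j)"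
      by (simp add: minus_one_power_iff)
    then show "of_nat (a choose j) * exp u ^ j * (- 1) ^ (a - j) =
        (- 1) ^ (a + j) * of_nat (a choose j) * exp (of_nat j * u)"
      by (simp add: exp_of_nat_mult)
  qed simp
  finally show ?thesis .
qed

text \<open>
  Both sides are the same finite combination of products
  \<open>exp (j * x) * exp ((j + k) * y)\<close>, which avoids any rearrangement of infinite sums.
  The lemma is used for complex variables and, to sum absolute values, for their norms.
\<close>

lemma egf_has_sum:
  fixes x y :: "'a :: {real_normed_field, banach}"
  shows "((\<lambda>(l1, l2). of_nat (egf_coeff a b l1 l2) * (x ^ l1 * y ^ l2 / (fact l1 * fact l2))) has_sum
     (exp (x + y) - 1) ^ a * (exp y - 1) ^ b) UNIV"
proof -
  let ?C = "\<lambda>j k. (- 1) ^ (a + j) * of_nat (a choose j) * ((- 1) ^ (b + k) * of_nat (b choose k)) :: 'a"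
  let ?E = "\<lambda>j k. exp (of_nat j * x) * exp (of_nat (j + k) * y)"
  let ?t = "\<lambda>j k (l1, l2). (of_nat j * x) ^ l1 / fact l1 * ((of_nat (j + k) * y) ^ l2 / fact l2)"
  have "((\<lambda>l. \<Sum>j\<le>a. \<Sum>k\<le>b. ?C j k * ?t j k l) has_sum
      (\<Sum>j\<le>a. \<Sum>k\<le>b. ?C j k * ?E j k)) (UNIV \<times> UNIV)"
    by (intro has_sum_sum finite_atMost has_sum_cmult_right has_sum_mult_Times
        exp_abs_summable exp_has_sum)
  moreover have "(\<lambda>l. \<Sum>j\<le>a. \<Sum>k\<le>b. ?C j k * ?t j k l) =
      (\<lambda>(l1, l2). of_nat (egf_coeff a b l1 l2) * (x ^ l1 * y ^ l2 / (fact l1 * fact l2)))"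
    by (simp add: fun_eq_iff egf_coeff_alternating_sum sum_distrib_left sum_divide_distrib
        power_mult_distrib mult_ac)
  moreover have "(\<Sum>j\<le>a. \<Sum>k\<le>b. ?C j k * ?E j k) = (exp (x + y) - 1) ^ a * (exp y - 1) ^ b"
  proof -
    have "?E j k = exp (of_nat j * (x + y)) * exp (of_nat k * y)" for j k
      by (simp add: exp_add[symmetric] algebra_simps)
    then show ?thesis
      unfolding exp_minus_1_power sum_product by (simp add: mult_ac)
  qed
  ultimately show ?thesis by simp
qed

section \<open>Substitution into a double power series\<close>

text \<open>
  The family \<open>F\<close> below is indexed by the exponents \<open>(a, b)\<close> of the outer series and the exponents
  \<open>(l1, l2)\<close> of the expansion of each of its terms. Summing \<open>F\<close> over \<open>(l1, l2)\<close> first gives the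
  value of the substituted series, summing over \<open>(a, b)\<close> first gives the coefficients of the
  expansion; absolute summability makes the two orders agree.
\<close>

lemma substitution_has_sum:
  fixes c :: "nat \<Rightarrow> nat \<Rightarrow> complex" and x y :: complex
  assumes c: "\<And>a b. norm (c a b) \<le> K * R ^ a * R ^ b"
    and R: "0 \<le> R" and small: "R * (exp (norm x + norm y) - 1) < 1"
  shows "((\<lambda>(l1, l2). (\<Sum>a\<le>l1 + l2. \<Sum>b\<le>l1 + l2. c a b * of_nat (egf_coeff a b l1 l2)) *
            (x ^ l1 * y ^ l2 / (fact l1 * fact l2))) has_sum
          (\<Sum>\<^sub>\<infinity>(a, b)\<in>UNIV. c a b * ((exp (x + y) - 1) ^ a * (exp y - 1) ^ b))) UNIV"
proof -
  define F where "F = (\<lambda>((a, b), (l1, l2)).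
    c a b * (of_nat (egf_coeff a b l1 l2) * (x ^ l1 * y ^ l2 / (fact l1 * fact l2))))"
  define u v where "u = exp (norm x + norm y) - 1" and "v = exp (norm y) - 1"
  have uv: "0 \<le> v" "v \<le> u" "0 \<le> R * u" "R * u < 1"
    using small R by (auto simp: u_def v_def)
  have K: "0 \<le> K"
    using order_trans[OF norm_ge_zero c[of 0 0]] by simp
  have norm_row: "((\<lambda>l. norm (F ((a, b), l))) has_sum norm (c a b) * (u ^ a * v ^ b)) UNIV" for a b
    using has_sum_cmult_right[OF egf_has_sum[of a b "norm x" "norm y"], of "norm (c a b)"]
    by (simp add: F_def u_def v_def case_prod_unfold norm_mult norm_divide norm_power)
  have geo: "(\<lambda>n. norm ((R * u) ^ n)) summable_on UNIV"
    using uv by (intro norm_summable_imp_summable_on) (simp add: norm_power summable_geometric)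
  have "(\<lambda>(a, b). (R * u) ^ a * (R * u) ^ b) summable_on (UNIV \<times> UNIV)"
    using has_sum_mult_Times[OF geo geo has_sum_infsum[OF abs_summable_summable[OF geo]]
        has_sum_infsum[OF abs_summable_summable[OF geo]]]
    by (rule has_sum_imp_summable)
  then have dom: "(\<lambda>p. K * (case p of (a, b) \<Rightarrow> (R * u) ^ a * (R * u) ^ b)) summable_on UNIV"
    by (intro summable_on_cmult_right) simp
  have "(\<lambda>(a, b). norm (c a b) * (u ^ a * v ^ b)) summable_on UNIV"
  proof (rule summable_on_comparison_test[OF dom])
    fix p :: "nat \<times> nat"
    obtain a b where p: "p = (a, b)" by fastforce
    have "norm (c a b) * (u ^ a * v ^ b) \<le> (K * R ^ a * R ^ b) * (u ^ a * u ^ b)"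
      using uv R K by (intro mult_mono c power_mono mult_nonneg_nonneg) auto
    then show "(case p of (a, b) \<Rightarrow> norm (c a b) * (u ^ a * v ^ b)) \<le>
        K * (case p of (a, b) \<Rightarrow> (R * u) ^ a * (R * u) ^ b)"
      by (simp add: p power_mult_distrib mult_ac)
    show "0 \<le> (case p of (a, b) \<Rightarrow> norm (c a b) * (u ^ a * v ^ b))"
      using uv by (simp add: p)
  qed
  then have "(\<lambda>q. norm (F q)) summable_on (UNIV \<times> UNIV)"
    by (rule summable_on_SigmaI[rotated]) (use norm_row in auto)
  then have F: "F summable_on (UNIV \<times> UNIV)"
    by (rule abs_summable_summable)
  have row: "((\<lambda>l. F (p, l)) has_sum
      (case p of (a, b) \<Rightarrow> c a b * ((exp (x + y) - 1) ^ a * (exp y - 1) ^ b))) UNIV" for p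
    using has_sum_cmult_right[OF egf_has_sum[of "fst p" "snd p" x y], of "c (fst p) (snd p)"]
    by (simp add: F_def case_prod_unfold)
  have col: "((\<lambda>p. F (p, l)) has_sum (case l of (l1, l2) \<Rightarrow>
      (\<Sum>a\<le>l1 + l2. \<Sum>b\<le>l1 + l2. c a b * of_nat (egf_coeff a b l1 l2)) *
        (x ^ l1 * y ^ l2 / (fact l1 * fact l2)))) UNIV" for l
  proof -
    obtain l1 l2 where l: "l = (l1, l2)" by fastforce
    show ?thesis
    proof (rule has_sum_finite_neutralI[of "{..l1 + l2} \<times> {..l1 + l2}"])
      show "F (p, l) = 0" if "p \<in> UNIV - {..l1 + l2} \<times> {..l1 + l2}" for p
        using that by (cases p) (auto simp: F_def l egf_coeff_eq_0)
      show "(case l of (l1, l2) \<Rightarrow>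
          (\<Sum>a\<le>l1 + l2. \<Sum>b\<le>l1 + l2. c a b * of_nat (egf_coeff a b l1 l2)) *
            (x ^ l1 * y ^ l2 / (fact l1 * fact l2))) =
          (\<Sum>p\<in>{..l1 + l2} \<times> {..l1 + l2}. F (p, l))"
        by (simp add: F_def l sum.cartesian_product' sum_distrib_right sum_divide_distrib mult.assoc)
    qed auto
  qed
  have "((\<lambda>p. case p of (a, b) \<Rightarrow> c a b * ((exp (x + y) - 1) ^ a * (exp y - 1) ^ b)) has_sum
      infsum F (UNIV \<times> UNIV)) UNIV"
    by (rule has_sum_SigmaD[OF has_sum_infsum[OF F] row])
  then have "infsum F (UNIV \<times> UNIV) =
      (\<Sum>\<^sub>\<infinity>(a, b)\<in>UNIV. c a b * ((exp (x + y) - 1) ^ a * (exp y - 1) ^ b))"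
    by (simp add: infsumI)
  moreover have "((\<lambda>(l, p). F (p, l)) has_sum infsum F (UNIV \<times> UNIV)) (UNIV \<times> UNIV)"
    using has_sum_infsum[OF F] has_sum_swap by blast
  then have "((\<lambda>l. case l of (l1, l2) \<Rightarrow>
      (\<Sum>a\<le>l1 + l2. \<Sum>b\<le>l1 + l2. c a b * of_nat (egf_coeff a b l1 l2)) *
        (x ^ l1 * y ^ l2 / (fact l1 * fact l2))) has_sum infsum F (UNIV \<times> UNIV)) UNIV"
    by (rule has_sum_SigmaD) (simp only: prod.case, rule col)
  ultimately show ?thesis by simp
qed

section \<open>The generating function and its explicit coefficients\<close>

text \<open>The indices are shifted from \<open>(m1, m2)\<close> to \<open>a = m1 - 1\<close> and \<open>b = m2 - m1 - 1\<close>.\<close>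

definition Li_weight :: "int \<Rightarrow> int \<Rightarrow> nat \<Rightarrow> nat \<Rightarrow> complex" where
  "Li_weight k1 k2 a b = 1 / (of_nat (a + 1) powi k1 * of_nat (a + b + 2) powi k2)"

lemma Li_sh_divide:
  assumes "z1 \<noteq> 0" "z2 \<noteq> 0"
  shows "Li_sh k1 k2 z1 z2 / (z1 * z2) = (\<Sum>\<^sub>\<infinity>(a, b)\<in>UNIV. Li_weight k1 k2 a b * (z1 ^ a * z2 ^ b))"
proof -
  have split_off: "z1 * z2 * (z1 ^ (m1 - Suc 0) * z2 ^ (m2 - Suc m1)) = z1 ^ m1 * z2 ^ (m2 - m1)"
    if "Suc 0 \<le> m1" "m1 < m2" for m1 m2
    using that by (auto dest!: less_imp_Suc_add simp: Suc_le_eq)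
  have "Li_sh k1 k2 z1 z2 = (\<Sum>\<^sub>\<infinity>p\<in>UNIV.
      z1 * z2 * (case p of (a, b) \<Rightarrow> Li_weight k1 k2 a b * (z1 ^ a * z2 ^ b)))"
    unfolding Li_sh_def
    by (rule infsum_reindex_bij_witness[of _ "\<lambda>(a, b). (a + 1, a + b + 2)" "\<lambda>(m1, m2). (m1 - 1, m2 - m1 - 1)"])
       (auto simp: Li_weight_def split_off)
  then show ?thesis
    using assms by (simp add: infsum_cmult_right')
qed

lemma norm_inverse_powi_le:
  assumes "0 < n"
  shows "norm (1 / of_nat n powi k :: complex) \<le> real n ^ nat \<bar>k\<bar>"
proof (cases "0 \<le> k")
  case True
  have "1 \<le> real n ^ nat k" using assms by simp
  then have "1 / real n ^ nat k \<le> 1" by (simp add: divide_le_eq)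
  with \<open>1 \<le> real n ^ nat k\<close> show ?thesis
    using True by (simp add: power_int_def norm_divide norm_power)
next
  case False
  then show ?thesis
    by (simp add: power_int_def norm_divide norm_power norm_inverse divide_inverse power_inverse)
qed

text \<open>
  The weights grow polynomially. A crude geometric bound suffices because only arguments near the
  origin matter.
\<close>

lemma norm_Li_weight_le:
  fixes k1 k2 :: int
  defines "R \<equiv> 2 ^ (nat \<bar>k1\<bar> + nat \<bar>k2\<bar>)"
  shows "norm (Li_weight k1 k2 a b) \<le> 2 ^ nat \<bar>k2\<bar> * R ^ a * R ^ b"
proof -
  let ?N = "nat \<bar>k1\<bar>" and ?M = "nat \<bar>k2\<bar>"
  have "a + 1 \<le> 2 ^ a" "a + b + 2 \<le> 2 ^ (a + b + 1)"
    using less_exp[of "a + b + 1"] by (simp_all add: Suc_le_eq)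
  then have le: "real (a + 1) \<le> 2 ^ a" "real (a + b + 2) \<le> 2 ^ (a + b + 1)"
    by (metis of_nat_le_iff of_nat_numeral of_nat_power)+
  have "norm (Li_weight k1 k2 a b) =
      norm (1 / of_nat (a + 1) powi k1 :: complex) * norm (1 / of_nat (a + b + 2) powi k2 :: complex)"
    by (simp add: Li_weight_def norm_divide norm_mult)
  also have "\<dots> \<le> real (a + 1) ^ ?N * real (a + b + 2) ^ ?M"
    by (intro mult_mono norm_inverse_powi_le) auto
  also have "\<dots> \<le> (2 ^ a) ^ ?N * (2 ^ (a + b + 1)) ^ ?M"
    by (intro mult_mono power_mono le) auto
  also have "\<dots> = 2 ^ (?M + (?N + ?M) * a + ?M * b)"
    by (simp flip: power_mult power_add add: algebra_simps)
  also have "\<dots> \<le> (2 :: real) ^ (?M + (?N + ?M) * a + (?N + ?M) * b)"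
    by (rule power_increasing) (auto simp: algebra_simps)
  also have "\<dots> = 2 ^ ?M * R ^ a * R ^ b"
    by (simp add: R_def power_add power_mult)
  finally show ?thesis .
qed

text \<open>
  The right-hand side of the theorem, grouped by where its signs come from: \<open>(- 1) ^ (l1 + l2)\<close> from
  substituting \<open>- x1\<close> and \<open>- x2\<close>, and \<open>(- 1) ^ (a + b)\<close> from
  \<open>1 - exp (- u) = - (exp (- u) - 1)\<close> for both arguments.
\<close>

definition poly_bernoulli_sum :: "int \<Rightarrow> int \<Rightarrow> nat \<Rightarrow> nat \<Rightarrow> complex" where
  "poly_bernoulli_sum k1 k2 l1 l2 = (- 1) ^ (l1 + l2) *
     (\<Sum>a\<le>l1 + l2. \<Sum>b\<le>l1 + l2.
        (- 1) ^ (a + b) * Li_weight k1 k2 a b * of_nat (egf_coeff a b l1 l2))"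

lemma poly_bernoulli_sum_expansion:
  "double_poly_bernoulli_expansion k1 k2 (poly_bernoulli_sum k1 k2)"
proof -
  define R :: real where "R = 2 ^ (nat \<bar>k1\<bar> + nat \<bar>k2\<bar>)"
  have R: "0 \<le> R" by (simp add: R_def)
  have "((\<lambda>p :: complex \<times> complex. R * (exp (norm (fst p) + norm (snd p)) - 1)) \<longlongrightarrow>
      R * (exp (norm (fst (0 :: complex, 0 :: complex)) + norm (snd (0 :: complex, 0 :: complex))) - 1))
      (nhds (0, 0))"
    by (intro tendsto_intros filterlim_ident)
  then have "\<forall>\<^sub>F p :: complex \<times> complex in nhds (0, 0).
      R * (exp (norm (fst p) + norm (snd p)) - 1) < 1"
    by (rule order_tendstoD) simp
  then show ?thesis
    unfolding double_poly_bernoulli_expansion_def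
  proof (eventually_elim, clarify)
    fix x y :: complex
    assume small: "R * (exp (norm (fst (x, y)) + norm (snd (x, y))) - 1) < 1"
      and nz: "1 - exp (- x - y) \<noteq> 0" "1 - exp (- y) \<noteq> 0"
    define c where "c = (\<lambda>a b. (- 1) ^ (a + b) * Li_weight k1 k2 a b)"
    have signs: "c a b * ((exp (- x + - y) - 1) ^ a * (exp (- y) - 1) ^ b) =
        Li_weight k1 k2 a b * ((1 - exp (- x - y)) ^ a * (1 - exp (- y)) ^ b)" for a b
    proof -
      have "(1 - exp (- x - y)) ^ a = (- 1) ^ a * (exp (- x + - y) - 1) ^ a"
        "(1 - exp (- y)) ^ b = (- 1) ^ b * (exp (- y) - 1) ^ b"
        by (simp_all flip: power_mult_distrib)
      then show ?thesis
        by (simp add: c_def power_add mult_ac)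
    qed
    have "((\<lambda>(l1, l2). (\<Sum>a\<le>l1 + l2. \<Sum>b\<le>l1 + l2. c a b * of_nat (egf_coeff a b l1 l2)) *
            ((- x) ^ l1 * (- y) ^ l2 / (fact l1 * fact l2))) has_sum
          (\<Sum>\<^sub>\<infinity>(a, b)\<in>UNIV. c a b * ((exp (- x + - y) - 1) ^ a * (exp (- y) - 1) ^ b))) UNIV"
    proof (rule substitution_has_sum[OF _ R])
      show "norm (c a b) \<le> 2 ^ nat \<bar>k2\<bar> * R ^ a * R ^ b" for a b
        using norm_Li_weight_le[of k1 k2 a b] by (simp add: c_def R_def norm_mult norm_power)
    qed (use small in simp)
    moreover have "(\<lambda>(l1, l2). (\<Sum>a\<le>l1 + l2. \<Sum>b\<le>l1 + l2. c a b * of_nat (egf_coeff a b l1 l2)) *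
            ((- x) ^ l1 * (- y) ^ l2 / (fact l1 * fact l2))) =
        (\<lambda>(l1, l2). poly_bernoulli_sum k1 k2 l1 l2 * (x ^ l1 * y ^ l2 / (fact l1 * fact l2)))"
      unfolding poly_bernoulli_sum_def c_def
      by (auto simp: fun_eq_iff power_minus[of x] power_minus[of y] power_add)
    ultimately show "((\<lambda>(l1, l2). poly_bernoulli_sum k1 k2 l1 l2 * (x ^ l1 * y ^ l2 / (fact l1 * fact l2))) has_sum
        Li_sh k1 k2 (1 - exp (- x - y)) (1 - exp (- y)) /
          ((1 - exp (- x - y)) * (1 - exp (- y)))) UNIV"
      by (simp only: Li_sh_divide[OF nz] signs)
  qed
qed

section \<open>Uniqueness of the expansion\<close>

text \<open>
  The value of a power series tends to its constant term at 0, so values on a punctured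
  neighbourhood determine that term; dividing by \<open>x\<close> then reaches the next coefficient.
\<close>

lemma powser_coeffs_eq_0:
  fixes a :: "nat \<Rightarrow> complex"
  assumes "0 < r" and sums: "\<And>x. x \<noteq> 0 \<Longrightarrow> norm x < r \<Longrightarrow> (\<lambda>n. a n * x ^ n) sums 0"
  shows "a n = 0"
proof (induction n rule: less_induct)
  case (less n)
  have "(\<lambda>m. a (m + n) * x ^ m) sums 0" if "x \<noteq> 0" "norm x < r" for x
  proof -
    have "(\<lambda>m. a (m + n) * x ^ (m + n)) sums (0 - (\<Sum>m<n. a m * x ^ m))"
      by (rule sums_split_initial_segment[OF sums[OF that]])
    also have "(\<Sum>m<n. a m * x ^ m) = 0"
      using less by simp
    finally have "(\<lambda>m. a (m + n) * x ^ (m + n) / x ^ n) sums ((0 - 0) / x ^ n)"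
      by (rule sums_divide)
    then show ?thesis
      using that by (simp add: power_add)
  qed
  from powser_limit_0_strong[OF \<open>0 < r\<close> this]
  have "((\<lambda>_. 0) \<longlongrightarrow> a (0 + n)) (at (0 :: complex))" .
  then show ?case
    using LIM_const_eq[of "0 :: complex" "a n" 0] by simp
qed

text \<open>
  For fixed \<open>y \<noteq> 0\<close> the excluded point \<open>x = - y\<close> lies outside the disc of radius \<open>norm y\<close>, so on
  that disc the series is a power series in \<open>x\<close> whose coefficients, the row sums, must vanish. Each
  row sum is in turn a power series in \<open>y\<close> that vanishes on a punctured disc.
\<close>

lemma double_powser_coeffs_eq_0:
  fixes D :: "nat \<Rightarrow> nat \<Rightarrow> complex"
  assumes "0 < e" and D: "\<And>x y. norm x < e \<Longrightarrow> norm y < e \<Longrightarrow> y \<noteq> 0 \<Longrightarrow> x + y \<noteq> 0 \<Longrightarrow>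
      ((\<lambda>(m, n). D m n * (x ^ m * y ^ n / (fact m * fact n))) has_sum 0) UNIV"
  shows "D m n = 0"
proof -
  have row: "((\<lambda>n. D m n * (y ^ n / fact n)) has_sum 0) UNIV" if y: "y \<noteq> 0" "norm y < e" for y m
  proof -
    define h where "h = (\<lambda>m. \<Sum>\<^sub>\<infinity>n\<in>UNIV. D m n * (y ^ n / fact n))"
    have h: "((\<lambda>n. D m n * (y ^ n / fact n)) has_sum h m) UNIV" for m
    proof -
      \<comment> \<open>One nonzero admissible \<open>x\<close>, here \<open>y / 2\<close>, makes every row summable.\<close>
      have "((\<lambda>(m, n). D m n * ((y / 2) ^ m * y ^ n / (fact m * fact n))) has_sum 0) UNIV"
        by (rule D) (use y \<open>0 < e\<close> in \<open>auto simp: norm_divide\<close>)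
      then have "(\<lambda>(m, n). D m n * ((y / 2) ^ m * y ^ n / (fact m * fact n))) summable_on (UNIV \<times> UNIV)"
        by (auto simp: summable_on_def)
      from summable_on_SigmaD1[OF this, of m]
      have "(\<lambda>n. D m n * ((y / 2) ^ m * y ^ n / (fact m * fact n))) summable_on UNIV"
        by simp
      then have "(\<lambda>n. (fact m / (y / 2) ^ m) * (D m n * ((y / 2) ^ m * y ^ n / (fact m * fact n))))
          summable_on UNIV"
        by (rule summable_on_cmult_right)
      moreover have "(\<lambda>n. (fact m / (y / 2) ^ m) * (D m n * ((y / 2) ^ m * y ^ n / (fact m * fact n)))) =
          (\<lambda>n. D m n * (y ^ n / fact n))"
        using y by (auto simp: fun_eq_iff field_simps)
      ultimately show ?thesis
        unfolding h_def by simp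
    qed
    have "(\<lambda>m. h m / fact m * x ^ m) sums 0" if x: "x \<noteq> 0" "norm x < norm y" for x
    proof -
      have "x + y \<noteq> 0"
        using x by (metis add_eq_0_iff norm_minus_cancel order_less_irrefl)
      then have "((\<lambda>(m, n). D m n * (x ^ m * y ^ n / (fact m * fact n))) has_sum 0) (UNIV \<times> UNIV)"
        using D[of x y] x y by simp
      moreover have "((\<lambda>n. case (m, n) of (m, n) \<Rightarrow> D m n * (x ^ m * y ^ n / (fact m * fact n)))
          has_sum h m / fact m * x ^ m) UNIV" for m
        using has_sum_cmult_right[OF h[of m], of "x ^ m / fact m"] by (simp add: mult_ac)
      ultimately have "((\<lambda>m. h m / fact m * x ^ m) has_sum 0) UNIV"
        by (rule has_sum_SigmaD)
      then show ?thesis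
        by (rule has_sum_imp_sums)
    qed
    then have "h m / fact m = 0"
      using powser_coeffs_eq_0[of "norm y" "\<lambda>m. h m / fact m"] y by simp
    then show ?thesis
      using h[of m] by simp
  qed
  have "D m n / fact n = 0"
  proof (rule powser_coeffs_eq_0[OF \<open>0 < e\<close>])
    show "(\<lambda>n. D m n / fact n * y ^ n) sums 0" if "y \<noteq> 0" "norm y < e" for y
      using has_sum_imp_sums[OF row[OF that, of m]] by simp
  qed
  then show ?thesis by simp
qed

text \<open>
  Identifies the excluded points near the origin: the zeros of \<open>1 - exp (- w)\<close> other than 0 have
  absolute value at least \<open>2 * pi\<close>.
\<close>

lemma one_minus_exp_neq_0:
  fixes w :: complex
  assumes "w \<noteq> 0" "norm w < 1"
  shows "1 - exp (- w) \<noteq> 0"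
proof
  assume "1 - exp (- w) = 0"
  then have "exp (- w) = 1" by simp
  then obtain n :: int where "Re (- w) = 0" "Im (- w) = of_int (2 * n) * pi"
    unfolding exp_eq_1 by blast
  then have w: "Re w = 0" "Im w = - (of_int (2 * n) * pi)" by simp_all
  with assms have "n \<noteq> 0" by (auto simp: complex_eq_iff)
  then have "1 * 1 \<le> \<bar>of_int (2 * n)\<bar> * pi"
    using pi_gt3 by (intro mult_mono) auto
  also have "\<dots> = \<bar>Im w\<bar>"
    by (simp add: w abs_mult)
  also have "\<dots> < 1"
    using abs_Im_le_cmod[of w] assms by simp
  finally show False by simp
qed

lemma double_poly_bernoulli_expansion_unique:
  assumes "double_poly_bernoulli_expansion k1 k2 B" "double_poly_bernoulli_expansion k1 k2 B'"
  shows "B = B'"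
proof -
  have "\<forall>\<^sub>F (x, y) in nhds (0, 0). 1 - exp (- x - y) \<noteq> 0 \<longrightarrow> 1 - exp (- y) \<noteq> 0 \<longrightarrow>
      ((\<lambda>(m, n). (B m n - B' m n) * (x ^ m * y ^ n / (fact m * fact n))) has_sum 0) UNIV"
    using assms unfolding double_poly_bernoulli_expansion_def
  proof eventually_elim
    case (elim p)
    obtain x y where p: "p = (x, y)" by fastforce
    show ?case
      unfolding p prod.case
    proof (intro impI)
      assume nz: "1 - exp (- x - y) \<noteq> 0" "1 - exp (- y) \<noteq> 0"
      let ?term = "\<lambda>B (m, n). B m n * (x ^ m * y ^ n / (fact m * fact n))"
      let ?S = "Li_sh k1 k2 (1 - exp (- x - y)) (1 - exp (- y)) / ((1 - exp (- x - y)) * (1 - exp (- y)))"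
      have "(?term B has_sum ?S) UNIV" "(?term B' has_sum ?S) UNIV"
        using elim[unfolded p prod.case] nz by simp_all
      then have "((\<lambda>q. ?term B q + - ?term B' q) has_sum (?S + - ?S)) UNIV"
        by (intro has_sum_add has_sum_uminusI)
      then show "((\<lambda>(m, n). (B m n - B' m n) * (x ^ m * y ^ n / (fact m * fact n))) has_sum 0) UNIV"
        by (simp add: case_prod_unfold left_diff_distrib diff_divide_distrib)
    qed
  qed
  then obtain d where "0 < d" and d: "\<And>x y. dist (x, y) (0, 0) < d \<Longrightarrow>
      1 - exp (- x - y) \<noteq> 0 \<Longrightarrow> 1 - exp (- y) \<noteq> 0 \<Longrightarrow>
      ((\<lambda>(m, n). (B m n - B' m n) * (x ^ m * y ^ n / (fact m * fact n))) has_sum 0) UNIV"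
    unfolding eventually_nhds_metric by (auto simp only: split_paired_All prod.case)
  have "B m n - B' m n = 0" for m n
  proof (rule double_powser_coeffs_eq_0[where e = "min (d / 2) (1 / 2)"])
    fix x y :: complex
    assume xy: "norm x < min (d / 2) (1 / 2)" "norm y < min (d / 2) (1 / 2)" "y \<noteq> 0" "x + y \<noteq> 0"
    have "norm (x + y) < 1"
      using norm_triangle_ineq[of x y] xy by simp
    then have "1 - exp (- x - y) \<noteq> 0" "1 - exp (- y) \<noteq> 0"
      using one_minus_exp_neq_0[of "x + y"] one_minus_exp_neq_0[of y] xy by auto
    moreover have "dist (x, y) (0, 0) < d"
      using norm_Pair_le[of x y] xy by (simp add: dist_norm flip: zero_prod_def)
    ultimately show "((\<lambda>(m, n). (B m n - B' m n) * (x ^ m * y ^ n / (fact m * fact n))) has_sum 0) UNIV"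
      using d by blast
  qed (use \<open>0 < d\<close> in auto)
  then show ?thesis by (simp add: fun_eq_iff)
qed

theorem theorem2p1:
  fixes l1 l2 :: nat and k1 k2 :: int
  shows "double_poly_bernoulli k1 k2 l1 l2 =
    (\<Sum>m1=0..l1 + l2. \<Sum>m2=0..l1 + l2.
       (- 1) ^ (m1 + m2 + l1 + l2) * fact m1 * fact m2 /
         (of_nat (m1 + 1) powi k1 * of_nat (m1 + m2 + 2) powi k2) *
       (\<Sum>n=0..l1 + l2.
          of_nat (Stirling n m1) * of_nat (Stirling (l1 + l2 - n) m2) *
          of_nat (binom_int l2 (int n - int l1))))"
proof -
  have "double_poly_bernoulli k1 k2 = poly_bernoulli_sum k1 k2"
    unfolding double_poly_bernoulli_def
    by (rule the_equality[of "double_poly_bernoulli_expansion k1 k2", OF poly_bernoulli_sum_expansion])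
       (rule double_poly_bernoulli_expansion_unique[OF _ poly_bernoulli_sum_expansion])
  then have "double_poly_bernoulli k1 k2 l1 l2 = poly_bernoulli_sum k1 k2 l1 l2"
    by simp
  also have "\<dots> = (\<Sum>m1=0..l1 + l2. \<Sum>m2=0..l1 + l2.
       (- 1) ^ (m1 + m2 + l1 + l2) * fact m1 * fact m2 /
         (of_nat (m1 + 1) powi k1 * of_nat (m1 + m2 + 2) powi k2) *
       (\<Sum>n=0..l1 + l2.
          of_nat (Stirling n m1) * of_nat (Stirling (l1 + l2 - n) m2) *
          of_nat (binom_int l2 (int n - int l1))))"
    unfolding poly_bernoulli_sum_def Li_weight_def egf_coeff_def atLeast0AtMost
      sum_distrib_left[of "(- 1) ^ (l1 + l2)"]
    by (intro sum.cong refl) (simp add: power_add mult_ac)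
  finally show ?thesis .
qed

end
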